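(* For $z\in\mathbb{C}$ with $|z|<1$, $$K^2(z)=\frac{\pi^2}{4}F^2\left(\tfrac12,\tfrac12;1;z^2\right)=\frac{\pi^2}{4}\sum_{n=0}^\infty u_n z^{2n},$$ where $u_0=1$, $u_1=1/2$ and $$u_{n+1}=\frac{n(n(2n+3)+2)+\frac12}{(n+1)^3}u_n-\frac{n^3}{(n+1)^3}u_{n-1},\qquad n\ge 1.$$
   Context: $K(z)=\int_0^{\pi/2}\frac{d\theta}{\sqrt{1-z^2\sin^2\theta}}$, $|z|<1$ (principal square root), is the complete elliptic integral of the first kind, and $K^2(z)=(K(z))^2$. $F(a,b;c;z)=\sum_{k=0}^\infty \frac{(a)_k(b)_k}{(c)_k\,k!}z^k$, $|z|<1$, is the Gaussian hypergeometric function, with $(x)_k=x(x+1)\cdots(x+k-1)$, $(x)_0=1$; $F^2$ denotes its square. *)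

theory Defs
  imports "HOL-Analysis.Analysis"
begin

definition ellipticK :: "complex \<Rightarrow> complex" where
  "ellipticK z =
     integral {0..pi/2} (\<lambda>\<theta>. 1 / csqrt (1 - z\<^sup>2 * complex_of_real ((sin \<theta>)\<^sup>2)))"

text \<open>Intended for \<open>norm z < 1\<close> and \<open>c\<close> not a nonpositive integer.\<close>

definition gauss_F :: "complex \<Rightarrow> complex \<Rightarrow> complex \<Rightarrow> complex \<Rightarrow> complex" where
  "gauss_F a b c z =
     (\<Sum>k. pochhammer a k * pochhammer b k / (pochhammer c k * fact k) * z ^ k)"

lemma gauss_F_eq_eval_fps: "gauss_F a b c z = eval_fps (fps_hypergeo [a, b] [c] 1) z"
  by (simp add: gauss_F_def eval_fps_def fps_hypergeo_nth)

end

theory Submission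
  imports Defs
begin

text \<open>
  Write \<open>c k = (1/2)\<^sub>k / k!\<close>. These numbers occur in two unrelated roles: they are the coefficients of
  the binomial series of \<open>1 / csqrt (1 - t)\<close>, and, up to the factor \<open>pi / 2\<close>, they are Wallis'
  integrals of \<open>sin\<^sup>2\<^sup>k\<close> over \<open>{0..pi / 2}\<close>. Expanding the integrand of \<open>K\<close> at
  \<open>t = z\<^sup>2 sin\<^sup>2 \<theta>\<close> and integrating term by term therefore produces the squares \<open>(c k)\<^sup>2\<close>, which are
  the coefficients of \<open>F(1/2, 1/2; 1; x)\<close>. The interchange is harmless because \<open>0 \<le> c k \<le> 1\<close>,
  so the geometric series in \<open>norm z\<^sup>2 < 1\<close> dominates uniformly in \<open>\<theta>\<close>.

  The recurrence comes from a differential equation. With \<open>\<theta> = x d/dx\<close>, the two-term recurrence of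
  \<open>(c k)\<^sup>2\<close> says that \<open>F\<close> satisfies \<open>\<theta>\<^sup>2 F = x (\<theta> + 1/2)\<^sup>2 F\<close>. The square of a solution of a
  second-order linear equation satisfies a third-order one, here (\<open>symmetric_square_ode\<close>)
  \<open>\<theta>\<^sup>3 W - x (2\<theta> + 1) (\<theta>\<^sup>2 + \<theta> + 1/2) W + x\<^sup>2 (\<theta> + 1)\<^sup>3 W = 0\<close>
  for \<open>W = F\<^sup>2\<close>. Since \<open>\<theta>\<close> multiplies the coefficient of \<open>x\<^sup>n\<close> by \<open>n\<close>, reading off the coefficient of
  \<open>x\<close> to the power \<open>n + 1\<close> gives exactly the three-term recurrence of \<open>u\<close>, because
  \<open>(2n + 1) (n\<^sup>2 + n + 1/2) = n (n (2n + 3) + 2) + 1/2\<close>. Hence \<open>u\<close> is the Cauchy square of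
  \<open>(c k)\<^sup>2\<close>, and absolute convergence turns the formal identity into one between functions.
  The equations are treated as identities of formal power series, which keeps this part algebraic.
\<close>

section \<open>The coefficients of the inverse square root\<close>

text \<open>This is \<open>(2k choose k) / 4\<^sup>k\<close>; the Pochhammer form is the one shared with the binomial and
  hypergeometric series.\<close>

definition half_coeff :: "nat \<Rightarrow> real" where
  "half_coeff k = pochhammer (1 / 2) k / fact k"

lemma half_coeff_0 [simp]: "half_coeff 0 = 1"
  by (simp add: half_coeff_def)

lemma half_coeff_Suc: "half_coeff (Suc k) = (real k + 1 / 2) / (real k + 1) * half_coeff k"
  by (simp add: half_coeff_def pochhammer_rec' algebra_simps)

lemma half_coeff_nonneg: "half_coeff k \<ge> 0"
  by (simp add: half_coeff_def pochhammer_nonneg)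

lemma half_coeff_le_1: "half_coeff k \<le> 1"
proof (induction k)
  case (Suc k)
  have "(real k + 1 / 2) / (real k + 1) \<le> 1"
    by simp
  with Suc show ?case
    unfolding half_coeff_Suc by (intro mult_le_one) (auto simp: half_coeff_nonneg)
qed simp

lemma of_real_half_coeff:
  "complex_of_real (half_coeff k) = pochhammer (1 / 2) k / fact k"
proof -
  have "complex_of_real (pochhammer (1 / 2) k) = pochhammer (complex_of_real (1 / 2)) k"
    by (rule pochhammer_of_real [symmetric])
  then show ?thesis
    by (simp add: half_coeff_def)
qed

lemma inverse_csqrt_series:
  fixes t :: complex
  assumes "norm t < 1"
  shows "(\<lambda>k. of_real (half_coeff k) * t ^ k) sums (1 / csqrt (1 - t))"
proof -
  have "(\<lambda>k. ((- 1 / 2) gchoose k) * (- t) ^ k) sums (1 + (- t)) powr (- 1 / 2)"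
    using assms by (intro gen_binomial_complex) simp
  moreover have "((- 1 / 2) gchoose k) * (- t) ^ k = of_real (half_coeff k) * t ^ k" for k
    by (simp add: gbinomial_pochhammer of_real_half_coeff power_mult_distrib [symmetric])
  moreover have "(1 + (- t)) powr (- 1 / 2) = 1 / csqrt (1 - t)"
    using powr_minus_divide [of "1 - t" "1 / 2"] by (simp add: csqrt_conv_powr)
  ultimately show ?thesis
    by simp
qed

text \<open>Wallis' integrals: the derivative of \<open>- cos \<theta> sin\<^sup>2\<^sup>k\<^sup>+\<^sup>1 \<theta>\<close> is
  \<open>(2k + 2) sin\<^sup>2\<^sup>k\<^sup>+\<^sup>2 \<theta> - (2k + 1) sin\<^sup>2\<^sup>k \<theta>\<close>, and this primitive vanishes at both ends of the
  interval, so consecutive integrals have the same ratio \<open>(2k + 1) / (2k + 2)\<close> as the coefficients.\<close>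

lemma has_integral_sin_power:
  "((\<lambda>\<theta>. sin \<theta> ^ (2 * k)) has_integral pi / 2 * half_coeff k) {0..pi / 2}"
proof (induction k)
  case 0
  show ?case
    using has_integral_const_real [of "1::real" 0 "pi / 2"] by simp
next
  case (Suc k)
  define G where "G \<theta> = - cos \<theta> * sin \<theta> ^ (2 * k + 1)" for \<theta> :: real
  define G' where "G' \<theta> = (2 * real k + 2) * sin \<theta> ^ (2 * Suc k)
    - (2 * real k + 1) * sin \<theta> ^ (2 * k)" for \<theta> :: real
  have "(G has_real_derivative G' \<theta>) (at \<theta>)" for \<theta>
  proof -
    have "(G has_real_derivative sin \<theta> * sin \<theta> ^ (2 * k + 1)
        - (2 * real k + 1) * (cos \<theta>)\<^sup>2 * sin \<theta> ^ (2 * k)) (at \<theta>)"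
      unfolding G_def
      by (rule derivative_eq_intros refl)+ (simp add: power2_eq_square algebra_simps)
    also have "sin \<theta> * sin \<theta> ^ (2 * k + 1)
        - (2 * real k + 1) * (cos \<theta>)\<^sup>2 * sin \<theta> ^ (2 * k) = G' \<theta>"
      unfolding cos_squared_eq by (simp add: G'_def algebra_simps power2_eq_square)
    finally show ?thesis .
  qed
  then have "(G' has_integral G (pi / 2) - G 0) {0..pi / 2}"
    by (intro fundamental_theorem_of_calculus)
      (auto intro: has_field_derivative_at_within
        simp: has_real_derivative_iff_has_vector_derivative [symmetric])
  then have "(G' has_integral 0) {0..pi / 2}"
    by (simp add: G_def)
  then have "((\<lambda>\<theta>. G' \<theta> + (2 * real k + 1) * sin \<theta> ^ (2 * k)) has_integral
      0 + (2 * real k + 1) * (pi / 2 * half_coeff k)) {0..pi / 2}"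
    by (intro has_integral_add has_integral_mult_right Suc)
  moreover have "(2 * real k + 1) * half_coeff k = (2 * real k + 2) * half_coeff (Suc k)"
    by (simp add: half_coeff_Suc divide_simps)
  from arg_cong [OF this, of "\<lambda>x. pi / 2 * x"]
  have "0 + (2 * real k + 1) * (pi / 2 * half_coeff k)
      = (2 * real k + 2) * (pi / 2 * half_coeff (Suc k))"
    by (simp add: algebra_simps)
  ultimately have "((\<lambda>\<theta>. (2 * real k + 2) * sin \<theta> ^ (2 * Suc k)) has_integral
      (2 * real k + 2) * (pi / 2 * half_coeff (Suc k))) {0..pi / 2}"
    by (simp only: G'_def diff_add_cancel)
  moreover have nz: "2 * real k + 2 \<noteq> 0"
    by linarith
  ultimately show ?case
    by (simp only: has_integral_mult_right_iff [OF nz] nonzero_mult_div_cancel_left [OF nz])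
qed

section \<open>The elliptic integral as a hypergeometric function\<close>

lemma summable_half_coeff_sq:
  fixes x :: complex
  assumes "norm x < 1"
  shows "summable (\<lambda>k. norm (of_real ((half_coeff k)\<^sup>2) * x ^ k))"
proof (rule summable_comparison_test')
  show "summable (\<lambda>k. norm x ^ k)"
    using assms by (simp add: summable_geometric)
  show "norm (norm (complex_of_real ((half_coeff k)\<^sup>2) * x ^ k)) \<le> norm x ^ k" for k
    by (simp add: norm_mult norm_power mult_left_le_one_le half_coeff_nonneg half_coeff_le_1
        power_le_one)
qed

lemma gauss_F_half_half_one:
  "gauss_F (1 / 2) (1 / 2) 1 x = (\<Sum>k. of_real ((half_coeff k)\<^sup>2) * x ^ k)"
  by (simp add: gauss_F_def of_real_half_coeff pochhammer_fact [symmetric] power2_eq_square)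

text \<open>Each term of the binomial series contributes one factor \<open>half_coeff k\<close> from the series and
  another from the integral of \<open>sin\<^sup>2\<^sup>k\<close>. Weierstrass' test with the majorant \<open>norm (z\<^sup>2) ^ k\<close>
  justifies integrating term by term.\<close>

lemma ellipticK_eq_gauss_F:
  assumes "norm z < 1"
  shows "ellipticK z = of_real (pi / 2) * gauss_F (1 / 2) (1 / 2) 1 (z\<^sup>2)"
proof -
  define f where "f = (\<lambda>k \<theta>. of_real (half_coeff k) * (z\<^sup>2 * of_real ((sin \<theta>)\<^sup>2)) ^ k)"
  define S where "S = (\<lambda>\<theta>. 1 / csqrt (1 - z\<^sup>2 * of_real ((sin \<theta>)\<^sup>2)))"
  have z2: "norm (z\<^sup>2) < 1"
    using assms by (simp add: norm_power power_less_one_iff)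
  have le: "norm (z\<^sup>2 * of_real ((sin \<theta>)\<^sup>2)) \<le> norm (z\<^sup>2)" for \<theta>
    by (simp add: norm_mult norm_power mult_left_le abs_square_le_1 power_le_one)
  have bound: "norm (f k \<theta>) \<le> norm (z\<^sup>2) ^ k" for k \<theta>
  proof -
    have "norm (f k \<theta>) = half_coeff k * norm (z\<^sup>2 * of_real ((sin \<theta>)\<^sup>2)) ^ k"
      by (simp add: f_def norm_mult norm_power half_coeff_nonneg)
    also have "\<dots> \<le> 1 * norm (z\<^sup>2) ^ k"
      by (intro mult_mono power_mono le half_coeff_le_1) (auto simp: half_coeff_nonneg)
    finally show ?thesis by simp
  qed
  have suminf_f: "(\<Sum>k. f k \<theta>) = S \<theta>" for \<theta>
    using inverse_csqrt_series [of "z\<^sup>2 * of_real ((sin \<theta>)\<^sup>2)"] le [of \<theta>] z2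
    by (auto simp: f_def S_def sums_iff)
  have "uniform_limit {0..pi / 2} (\<lambda>n \<theta>. \<Sum>k<n. f k \<theta>) S sequentially"
    using Weierstrass_m_test [of "{0..pi / 2}" f "\<lambda>k. norm (z\<^sup>2) ^ k"] bound z2
    by (simp add: summable_geometric suminf_f)
  moreover have "continuous_on {0..pi / 2} (\<lambda>\<theta>. \<Sum>k<n. f k \<theta>)" for n
    unfolding f_def by (intro continuous_intros)
  ultimately obtain I J where IJ:
    "\<And>n. ((\<lambda>\<theta>. \<Sum>k<n. f k \<theta>) has_integral I n) {0..pi / 2}"
    "(S has_integral J) {0..pi / 2}" "I \<longlonglongrightarrow> J"
    by (rule uniform_limit_integral) auto
  have "(f k has_integral of_real (pi / 2) * (of_real ((half_coeff k)\<^sup>2) * (z\<^sup>2) ^ k)) {0..pi / 2}"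
    for k
  proof -
    have "((\<lambda>\<theta>. of_real (half_coeff k) * (z\<^sup>2) ^ k * complex_of_real (sin \<theta> ^ (2 * k)))
        has_integral of_real (half_coeff k) * (z\<^sup>2) ^ k * of_real (pi / 2 * half_coeff k)) {0..pi / 2}"
      by (intro has_integral_mult_right has_integral_of_real has_integral_sin_power)
    then show ?thesis
      by (simp add: f_def power_mult_distrib power_mult power2_eq_square mult_ac)
  qed
  then have "((\<lambda>\<theta>. \<Sum>k<n. f k \<theta>) has_integral
      (\<Sum>k<n. of_real (pi / 2) * (of_real ((half_coeff k)\<^sup>2) * (z\<^sup>2) ^ k))) {0..pi / 2}" for n
    by (intro has_integral_sum) auto
  with IJ(1) have "I = (\<lambda>n. \<Sum>k<n. of_real (pi / 2) * (of_real ((half_coeff k)\<^sup>2) * (z\<^sup>2) ^ k))"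
    by (intro ext) (rule has_integral_unique)
  with IJ(3) have "(\<lambda>k. of_real (pi / 2) * (of_real ((half_coeff k)\<^sup>2) * (z\<^sup>2) ^ k)) sums J"
    by (simp only: sums_def)
  moreover have "(\<lambda>k. of_real (pi / 2) * (of_real ((half_coeff k)\<^sup>2) * (z\<^sup>2) ^ k)) sums
      (of_real (pi / 2) * gauss_F (1 / 2) (1 / 2) 1 (z\<^sup>2))"
    unfolding gauss_F_half_half_one
    by (intro sums_mult summable_sums summable_norm_cancel [OF summable_half_coeff_sq] z2)
  ultimately have "J = of_real (pi / 2) * gauss_F (1 / 2) (1 / 2) 1 (z\<^sup>2)"
    by (rule sums_unique2)
  with IJ(2) show ?thesis
    by (simp add: ellipticK_def S_def integral_unique)
qed

section \<open>The recurrence for the squared series\<close>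

text \<open>The hypothesis is \<open>\<theta>\<^sup>2 f = x (\<theta> + 1/2)\<^sup>2 f\<close>, scaled by 4 and solved for \<open>(1 - x) \<theta>\<^sup>2 f\<close>; the
  conclusion is scaled by 2. The scaling avoids division, so that any integral domain will do. By
  Leibniz' rule the derivatives of \<open>w = f\<^sup>2\<close> up to order three are polynomials in \<open>f\<close>, \<open>\<theta> f\<close>,
  \<open>\<theta>\<^sup>2 f\<close>, \<open>\<theta>\<^sup>3 f\<close>. The coefficient of \<open>\<theta>\<^sup>3 w\<close> in the conclusion is \<open>2 (1 - x)\<^sup>2\<close> and that of \<open>\<theta>\<^sup>2 w\<close>
  is a multiple of \<open>1 - x\<close>, so the hypothesis and its first derivative can be used to eliminate
  \<open>\<theta>\<^sup>2 f\<close> and \<open>\<theta>\<^sup>3 f\<close>, after which everything cancels.\<close>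

lemma symmetric_square_ode:
  fixes f :: "'a :: idom fps"
  defines "\<theta> \<equiv> \<lambda>g. fps_X * fps_deriv g"
  assumes ode: "4 * (\<theta> (\<theta> f) - fps_X * \<theta> (\<theta> f)) = fps_X * (4 * \<theta> f + f)"
  defines "w \<equiv> f * f"
  shows "2 * \<theta> (\<theta> (\<theta> w))
    - fps_X * (4 * \<theta> (\<theta> (\<theta> w)) + 6 * \<theta> (\<theta> w) + 4 * \<theta> w + w)
    + 2 * (fps_X * (fps_X * (\<theta> (\<theta> (\<theta> w)) + 3 * \<theta> (\<theta> w) + 3 * \<theta> w + w))) = 0"
proof -
  have \<theta>_mult: "\<theta> (g * h) = g * \<theta> h + \<theta> g * h" for g h
    by (simp add: \<theta>_def algebra_simps)
  have \<theta>_add: "\<theta> (g + h) = \<theta> g + \<theta> h" and \<theta>_diff: "\<theta> (g - h) = \<theta> g - \<theta> h" for g h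
    by (simp_all add: \<theta>_def algebra_simps)
  have \<theta>_X: "\<theta> fps_X = fps_X" and \<theta>_2: "\<theta> 2 = 0" and \<theta>_4: "\<theta> 4 = 0"
    by (simp_all add: \<theta>_def)
  define f1 where "f1 = \<theta> f"
  define f2 where "f2 = \<theta> f1"
  define f3 where "f3 = \<theta> f2"
  have "\<theta> (4 * (f2 - fps_X * f2)) = \<theta> (fps_X * (4 * f1 + f))"
    using ode by (simp add: f2_def f1_def)
  \<comment> \<open>Differentiating the equation expresses \<open>(1 - x) \<theta>\<^sup>3 f\<close> by lower derivatives.\<close>
  then have ode': "4 * (f3 - fps_X * f3 - fps_X * f2) = fps_X * (4 * f2 + f1) + fps_X * (4 * f1 + f)"
    by (simp add: \<theta>_mult \<theta>_add \<theta>_diff \<theta>_X \<theta>_4 f3_def [symmetric] f2_def [symmetric]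
        f1_def [symmetric] algebra_simps)
  define w1 where "w1 = \<theta> w"
  define w2 where "w2 = \<theta> w1"
  define w3 where "w3 = \<theta> w2"
  have w1: "w1 = 2 * f * f1"
    by (simp add: w1_def w_def \<theta>_mult f1_def algebra_simps)
  have w2: "w2 = 2 * f1 * f1 + 2 * f * f2"
    by (simp add: w2_def w1 \<theta>_mult \<theta>_add \<theta>_2 f2_def f1_def algebra_simps)
  have w3: "w3 = 6 * f1 * f2 + 2 * f * f3"
    by (simp add: w3_def w2 \<theta>_mult \<theta>_add \<theta>_2 f3_def f2_def f1_def algebra_simps)
  have "4 * (f2 - fps_X * f2) = fps_X * (4 * f1 + f)"
    using ode by (simp add: f2_def f1_def)
  with ode' have "2 * w3 - fps_X * (4 * w3 + 6 * w2 + 4 * w1 + w)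
    + 2 * (fps_X * (fps_X * (w3 + 3 * w2 + 3 * w1 + w))) = 0"
    unfolding w3 w2 w1 w_def by algebra
  then show ?thesis
    by (simp only: w3_def w2_def w1_def)
qed

text \<open>This is the coefficient with index \<open>n + 1\<close> in the third-order equation of the generating function
  \<open>W = (\<Sum>n. w n * x\<^sup>n)\<close>: the factors \<open>x\<close> and \<open>x\<^sup>2\<close> shift the index by one and by two, so that
  \<open>\<theta>\<^sup>3\<close>, \<open>x (2\<theta> + 1) (\<theta>\<^sup>2 + \<theta> + 1/2)\<close> and \<open>x\<^sup>2 (\<theta> + 1)\<^sup>3\<close> contribute \<open>w (n + 1)\<close>, \<open>w n\<close> and
  \<open>w (n - 1)\<close>.\<close>

lemma convolution_square_recurrence:
  fixes a :: "nat \<Rightarrow> real"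
  assumes a_Suc: "\<And>n. (real n + 1)\<^sup>2 * a (Suc n) = (real n + 1 / 2)\<^sup>2 * a n"
  defines "w \<equiv> \<lambda>n. \<Sum>k\<le>n. a k * a (n - k)"
  assumes n: "n \<ge> 1"
  shows "(real n + 1) ^ 3 * w (n + 1)
    = (real n * (real n * (2 * real n + 3) + 2) + 1 / 2) * w n - real n ^ 3 * w (n - 1)"
proof -
  define f where "f = Abs_fps a"
  define \<theta> where "\<theta> = (\<lambda>g :: real fps. fps_X * fps_deriv g)"
  have \<theta>_nth: "fps_nth (\<theta> g) k = real k * fps_nth g k" for g k
    by (cases k) (simp_all add: \<theta>_def)
  define W where "W = f * f"
  have W_nth: "fps_nth W k = w k" for k
    by (simp add: W_def f_def w_def fps_mult_nth atLeast0AtMost)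
  have "4 * (\<theta> (\<theta> f) - fps_X * \<theta> (\<theta> f)) = fps_X * (4 * \<theta> f + f)"
  proof (rule fps_ext)
    fix k
    show "fps_nth (4 * (\<theta> (\<theta> f) - fps_X * \<theta> (\<theta> f))) k = fps_nth (fps_X * (4 * \<theta> f + f)) k"
    proof (cases k)
      case 0
      then show ?thesis by (simp add: \<theta>_nth fps_numeral_fps_const)
    next
      case (Suc m)
      then show ?thesis
        using a_Suc [of m]
        by (simp add: \<theta>_nth fps_numeral_fps_const f_def power2_eq_square algebra_simps)
    qed
  qed
  from symmetric_square_ode [OF this [unfolded \<theta>_def]]
  have ode: "2 * \<theta> (\<theta> (\<theta> W))
    - fps_X * (4 * \<theta> (\<theta> (\<theta> W)) + 6 * \<theta> (\<theta> W) + 4 * \<theta> W + W)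
    + 2 * (fps_X * (fps_X * (\<theta> (\<theta> (\<theta> W)) + 3 * \<theta> (\<theta> W) + 3 * \<theta> W + W))) = 0"
    by (simp add: \<theta>_def W_def)
  \<comment> \<open>The operator \<open>(\<theta> + 1)\<^sup>3\<close> multiplies the coefficient with index \<open>m = n - 1\<close> by \<open>(m + 1)\<^sup>3 = n\<^sup>3\<close>.\<close>
  obtain m where m: "n = Suc m"
    using n by (cases n) auto
  have "2 * (real n + 1) ^ 3 * w (n + 1) - (4 * real n ^ 3 + 6 * (real n)\<^sup>2 + 4 * real n + 1) * w n
      + 2 * (real m ^ 3 + 3 * (real m)\<^sup>2 + 3 * real m + 1) * w m = 0"
    using arg_cong [OF ode, of "\<lambda>g. fps_nth g (Suc n)"] unfolding m
    by (simp add: \<theta>_nth W_nth fps_numeral_fps_const power2_eq_square power3_eq_cube algebra_simps)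
  moreover have "real m ^ 3 + 3 * (real m)\<^sup>2 + 3 * real m + 1 = real n ^ 3"
    by (simp add: m power2_eq_square power3_eq_cube algebra_simps)
  moreover have "4 * real n ^ 3 + 6 * (real n)\<^sup>2 + 4 * real n + 1
      = 2 * (real n * (real n * (2 * real n + 3) + 2) + 1 / 2)"
    by (simp add: power2_eq_square power3_eq_cube algebra_simps)
  moreover have "w m = w (n - 1)"
    by (simp add: m)
  ultimately have "2 * (real n + 1) ^ 3 * w (n + 1)
    - 2 * (real n * (real n * (2 * real n + 3) + 2) + 1 / 2) * w n + 2 * real n ^ 3 * w (n - 1) = 0"
    by (simp only:)
  then show ?thesis
    by linarith
qed

section \<open>The power series of the squared elliptic integral\<close>

theorem corollary2p2:
  fixes u :: "nat \<Rightarrow> real" and z :: complex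
  assumes u_0: "u 0 = 1"
    and u_1: "u 1 = 1 / 2"
    and u_rec: "\<And>n. n \<ge> 1 \<Longrightarrow>
      u (n + 1) =
        (real n * (real n * (2 * real n + 3) + 2) + 1 / 2) / (real n + 1) ^ 3 * u n
        - real n ^ 3 / (real n + 1) ^ 3 * u (n - 1)"
    and z: "norm z < 1"
  shows "(ellipticK z)\<^sup>2 = complex_of_real (pi\<^sup>2 / 4) * (gauss_F (1 / 2) (1 / 2) 1 (z\<^sup>2))\<^sup>2
    \<and> summable (\<lambda>n. complex_of_real (u n) * z ^ (2 * n))
    \<and> complex_of_real (pi\<^sup>2 / 4) * (gauss_F (1 / 2) (1 / 2) 1 (z\<^sup>2))\<^sup>2
        = complex_of_real (pi\<^sup>2 / 4) * (\<Sum>n. complex_of_real (u n) * z ^ (2 * n))"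
proof -
  define a where "a = (\<lambda>k. (half_coeff k)\<^sup>2)"
  define w where "w = (\<lambda>n. \<Sum>k\<le>n. a k * a (n - k))"
  have a_Suc: "(real n + 1)\<^sup>2 * a (Suc n) = (real n + 1 / 2)\<^sup>2 * a n" for n
    by (simp add: a_def half_coeff_Suc power_mult_distrib power_divide)
  have u_eq: "u n = w n" for n
  proof (induction n rule: less_induct)
    case (less n)
    consider "n = 0" | "n = 1" | m where "n = m + 1" "m \<ge> 1"
      by (metis One_nat_def Suc_eq_plus1 le_add2 not0_implies_Suc plus_1_eq_Suc less_one not_less)
    then show ?case
    proof cases
      case 1
      then show ?thesis by (simp add: u_0 w_def a_def)
    next
      case 2
      then show ?thesis
        using u_1 by (simp add: w_def a_def half_coeff_Suc power2_eq_square)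
    next
      case 3
      have "(real m + 1) ^ 3 * w (m + 1)
        = (real m * (real m * (2 * real m + 3) + 2) + 1 / 2) * w m - real m ^ 3 * w (m - 1)"
        unfolding w_def by (rule convolution_square_recurrence [OF a_Suc 3(2)])
      then have "w (m + 1) = ((real m * (real m * (2 * real m + 3) + 2) + 1 / 2) * w m
          - real m ^ 3 * w (m - 1)) / (real m + 1) ^ 3"
        by (simp add: eq_divide_eq mult.commute)
      moreover have "u m = w m" "u (m - 1) = w (m - 1)"
        using 3 by (auto intro: less)
      ultimately show ?thesis
        using u_rec [OF 3(2)] 3(1) by (simp add: diff_divide_distrib)
    qed
  qed
  have z2: "norm (z\<^sup>2) < 1"
    using z by (simp add: norm_power power_less_one_iff)
  have "(\<lambda>n. \<Sum>k\<le>n. (of_real (a k) * (z\<^sup>2) ^ k) * (of_real (a (n - k)) * (z\<^sup>2) ^ (n - k)))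
      sums ((gauss_F (1 / 2) (1 / 2) 1 (z\<^sup>2))\<^sup>2)"
    using Cauchy_product_sums [OF summable_half_coeff_sq [OF z2] summable_half_coeff_sq [OF z2]]
    by (simp add: a_def gauss_F_half_half_one power2_eq_square)
  moreover have "(\<Sum>k\<le>n. (of_real (a k) * (z\<^sup>2) ^ k) * (of_real (a (n - k)) * (z\<^sup>2) ^ (n - k)))
      = complex_of_real (u n) * z ^ (2 * n)" for n
  proof -
    have "(of_real (a k) * (z\<^sup>2) ^ k) * (of_real (a (n - k)) * (z\<^sup>2) ^ (n - k))
        = complex_of_real (a k * a (n - k)) * z ^ (2 * n)" if "k \<in> {..n}" for k
    proof -
      have "(z\<^sup>2) ^ k * (z\<^sup>2) ^ (n - k) = z ^ (2 * n)"
        using that by (simp add: power_mult flip: power_add)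
      then show ?thesis
        by (simp add: mult_ac)
    qed
    then have "(\<Sum>k\<le>n. (of_real (a k) * (z\<^sup>2) ^ k) * (of_real (a (n - k)) * (z\<^sup>2) ^ (n - k)))
        = (\<Sum>k\<le>n. complex_of_real (a k * a (n - k)) * z ^ (2 * n))"
      by (intro sum.cong refl)
    then show ?thesis
      by (simp add: u_eq w_def sum_distrib_right)
  qed
  ultimately have sums: "(\<lambda>n. complex_of_real (u n) * z ^ (2 * n)) sums
      ((gauss_F (1 / 2) (1 / 2) 1 (z\<^sup>2))\<^sup>2)"
    by simp
  have "(ellipticK z)\<^sup>2 = complex_of_real (pi\<^sup>2 / 4) * (gauss_F (1 / 2) (1 / 2) 1 (z\<^sup>2))\<^sup>2"
    by (simp add: ellipticK_eq_gauss_F [OF z] power_mult_distrib power_divide)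
  with sums show ?thesis
    by (simp add: sums_iff)
qed

end
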